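(* Let $P,Q$ be two probability distributions on the same measurable space and write $E_P,E_Q$ for the expectations with respect to $P$ and $Q$. Then for any (real-valued) random variable $X$ on this space and any real numbers $u,v$, $$\frac15\big(1-H^2(P,Q)\big)^2\,|u-v|\ \le\ E_P\big[|X-u|\big]\vee E_Q\big[|X-v|\big].$$
   Context: $a\vee b$ denotes $\max(a,b)$. The squared Hellinger distance is $H^2(P,Q)=H(P,Q)^2:=\frac12\int\big(\sqrt{p(\omega)}-\sqrt{q(\omega)}\big)^2\,d\nu(\omega)$, where $\nu$ is a measure dominating both $P$ and $Q$ and $p,q$ are the $\nu$-densities of $P$ and $Q$ (the value does not depend on the choice of $\nu$). The expectations on the right-hand side are of nonnegative random variables and may take the value $+\infty$. *)

theory Defs
  imports "HOL-Probability.Probability"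
begin

definition sum_measure :: "'a measure \<Rightarrow> 'a measure \<Rightarrow> 'a measure" where
  "sum_measure P Q = measure_of (space P) (sets P) (\<lambda>A. emeasure P A + emeasure Q A)"

text \<open>The dominating measure in the squared Hellinger distance is fixed to be the sum of the two
  measures. Lemma \<open>hellinger_sq_density\<close> below shows that every other choice of dominating
  measure and of densities gives the same value.\<close>

definition hellinger_sq :: "'a measure \<Rightarrow> 'a measure \<Rightarrow> real" where
  "hellinger_sq P Q =
     1 / 2 * (\<integral>x. (sqrt (enn2real (RN_deriv (sum_measure P Q) P x))
                - sqrt (enn2real (RN_deriv (sum_measure P Q) Q x)))\<^sup>2 \<partial>sum_measure P Q)"

lemma space_sum_measure [simp]: "space (sum_measure P Q) = space P"
  and sets_sum_measure [simp, measurable_cong]: "sets (sum_measure P Q) = sets P"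
  by (simp_all add: sum_measure_def)

lemma emeasure_sum_measure:
  assumes "sets Q = sets P" and A: "A \<in> sets P"
  shows "emeasure (sum_measure P Q) A = emeasure P A + emeasure Q A"
proof (rule emeasure_measure_of[OF sum_measure_def])
  show "sets P \<subseteq> Pow (space P)" by (rule sets.space_closed)
  show "positive (sets (sum_measure P Q)) (\<lambda>A. emeasure P A + emeasure Q A)"
    by (simp add: positive_def)
  show "countably_additive (sets (sum_measure P Q)) (\<lambda>A. emeasure P A + emeasure Q A)"
  proof (rule countably_additiveI)
    fix B :: "nat \<Rightarrow> 'a set"
    assume B: "range B \<subseteq> sets (sum_measure P Q)" "disjoint_family B"
    then have "range B \<subseteq> sets P" "range B \<subseteq> sets Q" using assms(1) by auto
    then show "(\<Sum>i. emeasure P (B i) + emeasure Q (B i)) = emeasure P (\<Union>(range B)) + emeasure Q (\<Union>(range B))"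
      using B(2) by (simp add: suminf_add[symmetric] suminf_emeasure)
  qed
  show "A \<in> sets (sum_measure P Q)" using A by simp
qed

lemma hellinger_sq_density:
  fixes f g :: "'a \<Rightarrow> real"
  assumes f [measurable]: "f \<in> borel_measurable \<nu>" and f0: "\<And>x. 0 \<le> f x"
    and g [measurable]: "g \<in> borel_measurable \<nu>" and g0: "\<And>x. 0 \<le> g x"
    and P: "P = density \<nu> (\<lambda>x. ennreal (f x))" "finite_measure P"
    and Q: "Q = density \<nu> (\<lambda>x. ennreal (g x))" "finite_measure Q"
  shows "integrable \<nu> (\<lambda>x. (sqrt (f x) - sqrt (g x))\<^sup>2)" (is ?I)
    and "hellinger_sq P Q = 1 / 2 * (\<integral>x. (sqrt (f x) - sqrt (g x))\<^sup>2 \<partial>\<nu>)" (is ?E)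
proof -
  define S where "S = sum_measure P Q"
  interpret P: finite_measure P by (rule P(2))
  interpret Q: finite_measure Q by (rule Q(2))
  have sP [simp, measurable_cong]: "sets P = sets \<nu>" "space P = space \<nu>" using P(1) by auto
  have sQ [simp, measurable_cong]: "sets Q = sets \<nu>" "space Q = space \<nu>" using Q(1) by auto
  have sS [simp, measurable_cong]: "sets S = sets \<nu>" "space S = space \<nu>" by (auto simp: S_def)
  have eS: "emeasure S A = emeasure P A + emeasure Q A" if "A \<in> sets \<nu>" for A
    using that by (simp add: S_def emeasure_sum_measure)
  have fS: "finite_measure S"
    by (rule finite_measureI)
       (metis eS sP(2) sQ(2) sS(2) sets.top P.emeasure_finite Q.emeasure_finite ennreal_add_eq_top infinity_ennreal_def)
  interpret S: finite_measure S by (rule fS)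
  have S: "S = density \<nu> (\<lambda>x. ennreal (f x + g x))"
  proof (rule measure_eqI)
    fix A assume "A \<in> sets S"
    then have A [measurable]: "A \<in> sets \<nu>" by simp
    show "emeasure S A = emeasure (density \<nu> (\<lambda>x. ennreal (f x + g x))) A"
      by (simp add: eS P(1) Q(1) emeasure_density f0 g0 ennreal_plus nn_integral_add[symmetric]
            distrib_right del: ennreal_plus[symmetric])
  qed simp
  have ac: "absolutely_continuous S P" "absolutely_continuous S Q"
    by (auto simp: absolutely_continuous_def null_sets_def eS)
  define p q where "p = RN_deriv S P" and "q = RN_deriv S Q"
  have [measurable]: "p \<in> borel_measurable S" "q \<in> borel_measurable S"
    by (simp_all add: p_def q_def)
  then have [measurable]: "p \<in> borel_measurable \<nu>" "q \<in> borel_measurable \<nu>"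
    using measurable_cong_sets[OF sS(1) refl] by auto
  have dp: "density S p = P" and dq: "density S q = Q"
    by (auto simp: p_def q_def intro!: S.density_RN_deriv ac)
  have eq: "AE x in \<nu>. ennreal (h x) = ennreal (f x + g x) * r x"
    if h [measurable]: "h \<in> borel_measurable \<nu>" and r [measurable]: "r \<in> borel_measurable \<nu>"
      and D: "density S r = density \<nu> (\<lambda>x. ennreal (h x))"
      and fin: "finite_measure (density \<nu> (\<lambda>x. ennreal (h x)))" for h :: "'a \<Rightarrow> real" and r
  proof -
    have "density \<nu> (\<lambda>x. ennreal (h x)) = density \<nu> (\<lambda>x. ennreal (f x + g x) * r x)"
      unfolding D[symmetric] S by (rule density_density_eq) auto
    moreover have "(\<integral>\<^sup>+x. ennreal (h x) \<partial>\<nu>) \<noteq> \<infinity>"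
      using finite_measure.finite_emeasure_space[OF fin]
      by (simp add: emeasure_density top_unique cong: nn_integral_cong)
    ultimately show ?thesis
      by (subst (asm) finite_density_unique) auto
  qed
  have eq_f: "AE x in \<nu>. ennreal (f x) = ennreal (f x + g x) * p x"
    by (rule eq[OF f]) (use dp P in simp_all)
  have eq_g: "AE x in \<nu>. ennreal (g x) = ennreal (f x + g x) * q x"
    by (rule eq[OF g]) (use dq Q in simp_all)
  have ae: "AE x in \<nu>. (f x + g x) * (sqrt (enn2real (p x)) - sqrt (enn2real (q x)))\<^sup>2
                 = (sqrt (f x) - sqrt (g x))\<^sup>2"
    using eq_f eq_g
  proof eventually_elim
    case (elim x)
    have "f x = (f x + g x) * enn2real (p x)" "g x = (f x + g x) * enn2real (q x)"
      using elim f0[of x] g0[of x] by (metis add_nonneg_nonneg enn2real_ennreal enn2real_mult)+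
    then have "sqrt (f x) = sqrt (f x + g x) * sqrt (enn2real (p x))"
       "sqrt (g x) = sqrt (f x + g x) * sqrt (enn2real (q x))"
      by (metis real_sqrt_mult)+
    then show ?case using f0[of x] g0[of x]
      by (simp add: right_diff_distrib[symmetric] power_mult_distrib)
  qed
  show ?E
  proof -
    have "(\<integral>x. (sqrt (enn2real (p x)) - sqrt (enn2real (q x)))\<^sup>2 \<partial>S)
        = (\<integral>x. (f x + g x) *\<^sub>R (sqrt (enn2real (p x)) - sqrt (enn2real (q x)))\<^sup>2 \<partial>\<nu>)"
      unfolding S by (rule integral_density) (auto simp: f0 g0)
    also have "\<dots> = (\<integral>x. (sqrt (f x) - sqrt (g x))\<^sup>2 \<partial>\<nu>)"
      by (rule integral_cong_AE) (use ae in auto)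
    finally show ?thesis by (simp add: hellinger_sq_def p_def q_def S_def)
  qed
  have int: "integrable \<nu> (\<lambda>x. f x + g x)"
    using S.finite_emeasure_space
    by (intro integrableI_nonneg) (auto simp: f0 g0 S emeasure_density top.not_eq_extremum cong: nn_integral_cong)
  have bound: "norm ((sqrt (f x) - sqrt (g x))\<^sup>2) \<le> norm (f x + g x)" for x
  proof -
    have "(sqrt (f x) - sqrt (g x))\<^sup>2 = f x + g x - 2 * sqrt (f x) * sqrt (g x)"
      by (simp add: power2_diff f0 g0)
    also have "\<dots> \<le> f x + g x" by (simp add: f0 g0)
    finally show ?thesis by (simp add: f0 g0)
  qed
  show ?I
    by (rule Bochner_Integration.integrable_bound[OF int _ AE_I2[OF bound]]) measurable
qed

end

theory Submission
  imports Defs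
begin

text \<open>
  Write \<open>p\<close>, \<open>q\<close> for densities of \<open>P\<close>, \<open>Q\<close> with respect to a common measure \<open>\<nu>\<close>,
  \<open>\<rho> = \<integral> sqrt (p * q) d\<nu>\<close> for the Hellinger affinity and \<open>m = \<integral> min p q d\<nu>\<close> for the overlap of
  the two distributions. Expanding the square shows \<open>1 - H\<^sup>2(P, Q) = \<rho>\<close>. The inequality follows from
  two comparisons.

  The overlap transports the triangle inequality \<open>\<bar>u - v\<bar> \<le> \<bar>X - u\<bar> + \<bar>X - v\<bar>\<close>: it is a
  subdensity of both \<open>P\<close> and \<open>Q\<close>, so multiplying by \<open>min p q\<close> and integrating gives
  \<open>m * \<bar>u - v\<bar> \<le> E\<^sub>P \<bar>X - u\<bar> + E\<^sub>Q \<bar>X - v\<bar>\<close>, which is at most twice the maximum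
  (\<open>overlap_triangle\<close>).

  The affinity is controlled by the overlap, \<open>\<rho>\<^sup>2 \<le> 2 * m\<close> (\<open>affinity_sq_le_overlap\<close>). This is the
  Cauchy-Schwarz bound \<open>\<rho>\<^sup>2 \<le> (\<integral> min p q) * (\<integral> max p q)\<close> with \<open>\<integral> max p q \<le> 2\<close>; integrating
  a pointwise arithmetic-geometric mean inequality yields it directly.

  Together these give the bound with the constant \<open>1/4\<close>, which is stronger than \<open>1/5\<close>.
\<close>

text \<open>The product \<open>a * b\<close> equals \<open>min a b * max a b\<close>, and the square
  \<open>(sqrt (min a b) - c / 2 * sqrt (max a b))\<^sup>2\<close> is nonnegative; then \<open>max a b \<le> a + b\<close>.
  After integration against probability densities with affinity \<open>\<rho>\<close> and overlap \<open>m\<close> this reads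
  \<open>c * \<rho> - c\<^sup>2 / 2 \<le> m\<close>, which is sharpest for the weight \<open>c = \<rho>\<close>.\<close>

lemma sqrt_mult_le_min_plus:
  fixes a b c :: real
  assumes "0 \<le> a" "0 \<le> b"
  shows "c * sqrt (a * b) \<le> min a b + c\<^sup>2 / 4 * (a + b)"
proof -
  have ordered: "c * sqrt (s * t) \<le> s + c\<^sup>2 / 4 * (s + t)" if "0 \<le> s" "0 \<le> t" for s t :: real
  proof -
    have "0 \<le> (sqrt s - c / 2 * sqrt t)\<^sup>2" by simp
    also have "\<dots> = s + c\<^sup>2 / 4 * t - c * sqrt (s * t)"
      using that by (simp add: power2_diff power_mult_distrib power_divide real_sqrt_mult)
    finally have "c * sqrt (s * t) \<le> s + c\<^sup>2 / 4 * t" by simp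
    also have "\<dots> \<le> s + c\<^sup>2 / 4 * (s + t)"
      using that by (intro add_left_mono mult_left_mono) auto
    finally show ?thesis .
  qed
  show ?thesis
  proof (cases "a \<le> b")
    case True
    then show ?thesis using ordered[of a b] assms by simp
  next
    case False
    then show ?thesis using ordered[of b a] assms by (simp add: mult.commute add.commute)
  qed
qed

lemma integrable_prob_density:
  fixes f :: "'a \<Rightarrow> real"
  assumes [measurable]: "f \<in> borel_measurable \<nu>" and f0: "\<And>x. 0 \<le> f x"
    and "prob_space (density \<nu> (\<lambda>x. ennreal (f x)))"
  shows "integrable \<nu> f" and "(\<integral>x. f x \<partial>\<nu>) = 1"
proof -
  have "(\<integral>\<^sup>+x. ennreal (f x) \<partial>\<nu>) = 1"
    using prob_space.emeasure_space_1[OF assms(3)]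
    by (simp add: emeasure_density cong: nn_integral_cong)
  then have "has_bochner_integral \<nu> f 1"
    by (intro has_bochner_integral_nn_integral) (auto simp: f0)
  then show "integrable \<nu> f" and "(\<integral>x. f x \<partial>\<nu>) = 1"
    by (auto simp: has_bochner_integral_iff)
qed

context
  fixes \<nu> P Q :: "'a measure" and f g :: "'a \<Rightarrow> real"
  assumes f [measurable]: "f \<in> borel_measurable \<nu>" and f0: "\<And>x. 0 \<le> f x"
    and g [measurable]: "g \<in> borel_measurable \<nu>" and g0: "\<And>x. 0 \<le> g x"
    and P: "P = density \<nu> (\<lambda>x. ennreal (f x))" and prob_P: "prob_space P"
    and Q: "Q = density \<nu> (\<lambda>x. ennreal (g x))" and prob_Q: "prob_space Q"
begin

lemma integral_f: "integrable \<nu> f" "(\<integral>x. f x \<partial>\<nu>) = 1"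
  using integrable_prob_density[OF f f0] prob_P P by auto

lemma integral_g: "integrable \<nu> g" "(\<integral>x. g x \<partial>\<nu>) = 1"
  using integrable_prob_density[OF g g0] prob_Q Q by auto

text \<open>Expanding the square, \<open>(sqrt f - sqrt g)\<^sup>2 = f + g - 2 * sqrt (f * g)\<close>, and \<open>f\<close> and \<open>g\<close>
  both integrate to one. The same identity gives the integrability of \<open>sqrt (f * g)\<close>.\<close>

lemma hellinger_affinity:
  shows "integrable \<nu> (\<lambda>x. sqrt (f x * g x))"
    and "1 - hellinger_sq P Q = (\<integral>x. sqrt (f x * g x) \<partial>\<nu>)"
proof -
  have fin: "finite_measure P" "finite_measure Q"
    using prob_P prob_Q by (auto intro: prob_space.finite_measure)
  note H = hellinger_sq_density[OF f f0 g g0 P fin(1) Q fin(2)]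
  have eq: "sqrt (f x * g x) = 1 / 2 * (f x + g x - (sqrt (f x) - sqrt (g x))\<^sup>2)" for x
    using f0[of x] g0[of x] by (simp add: power2_diff real_sqrt_mult)
  show "integrable \<nu> (\<lambda>x. sqrt (f x * g x))"
    unfolding eq using H(1) integral_f(1) integral_g(1) by simp
  show "1 - hellinger_sq P Q = (\<integral>x. sqrt (f x * g x) \<partial>\<nu>)"
    unfolding eq using H integral_f integral_g by simp
qed

lemma integrable_overlap: "integrable \<nu> (\<lambda>x. min (f x) (g x))"
  using integral_f(1) integral_g(1) by (rule integrable_min)

text \<open>Integrating the pointwise inequality with weight \<open>c = \<rho>\<close> gives
  \<open>\<rho> * \<rho> \<le> m + \<rho>\<^sup>2 / 4 * 2\<close>, so half of \<open>\<rho>\<^sup>2\<close> is absorbed on the left.\<close>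

lemma affinity_sq_le_overlap:
  "(1 - hellinger_sq P Q)\<^sup>2 \<le> 2 * (\<integral>x. min (f x) (g x) \<partial>\<nu>)"
proof -
  define \<rho> where "\<rho> = 1 - hellinger_sq P Q"
  have "\<rho> * \<rho> = (\<integral>x. \<rho> * sqrt (f x * g x) \<partial>\<nu>)"
    using hellinger_affinity by (simp add: \<rho>_def)
  also have "\<dots> \<le> (\<integral>x. min (f x) (g x) + \<rho>\<^sup>2 / 4 * (f x + g x) \<partial>\<nu>)"
    using hellinger_affinity(1) integral_f(1) integral_g(1) integrable_overlap f0 g0
    by (intro integral_mono sqrt_mult_le_min_plus) auto
  also have "\<dots> = (\<integral>x. min (f x) (g x) \<partial>\<nu>) + \<rho>\<^sup>2 / 2"
    using integral_f integral_g integrable_overlap by simp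
  finally show ?thesis by (simp add: \<rho>_def power2_eq_square)
qed

text \<open>Pointwise, \<open>min f g * \<bar>u - v\<bar> \<le> f * \<bar>X - u\<bar> + g * \<bar>X - v\<bar>\<close> by the triangle inequality.
  The integrals on the right are taken in \<^typ>\<open>ennreal\<close>, since \<open>X\<close> may fail to be integrable.\<close>

lemma overlap_triangle:
  fixes X :: "'a \<Rightarrow> real" and u v :: real
  assumes X [measurable]: "X \<in> borel_measurable \<nu>"
  shows "ennreal ((\<integral>x. min (f x) (g x) \<partial>\<nu>) * \<bar>u - v\<bar>)
      \<le> (\<integral>\<^sup>+x. ennreal \<bar>X x - u\<bar> \<partial>P) + (\<integral>\<^sup>+x. ennreal \<bar>X x - v\<bar> \<partial>Q)"
proof -
  have pointwise: "min (f x) (g x) * \<bar>u - v\<bar> \<le> f x * \<bar>X x - u\<bar> + g x * \<bar>X x - v\<bar>" for x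
  proof -
    have "min (f x) (g x) * \<bar>u - v\<bar> \<le> min (f x) (g x) * (\<bar>X x - u\<bar> + \<bar>X x - v\<bar>)"
      using f0[of x] g0[of x] by (intro mult_left_mono) auto
    also have "\<dots> \<le> f x * \<bar>X x - u\<bar> + g x * \<bar>X x - v\<bar>"
      unfolding distrib_left by (intro add_mono mult_right_mono) auto
    finally show ?thesis .
  qed
  have "ennreal ((\<integral>x. min (f x) (g x) \<partial>\<nu>) * \<bar>u - v\<bar>)
      = ennreal (\<integral>x. min (f x) (g x) * \<bar>u - v\<bar> \<partial>\<nu>)"
    by simp
  also have "\<dots> = (\<integral>\<^sup>+x. ennreal (min (f x) (g x) * \<bar>u - v\<bar>) \<partial>\<nu>)"
    using integrable_overlap f0 g0 by (intro nn_integral_eq_integral[symmetric]) auto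
  also have "\<dots> \<le> (\<integral>\<^sup>+x. ennreal (f x * \<bar>X x - u\<bar> + g x * \<bar>X x - v\<bar>) \<partial>\<nu>)"
    by (intro nn_integral_mono ennreal_leI pointwise)
  also have "\<dots> = (\<integral>\<^sup>+x. ennreal (f x) * ennreal \<bar>X x - u\<bar> + ennreal (g x) * ennreal \<bar>X x - v\<bar> \<partial>\<nu>)"
    by (simp add: ennreal_plus ennreal_mult f0 g0)
  also have "\<dots> = (\<integral>\<^sup>+x. ennreal \<bar>X x - u\<bar> \<partial>P) + (\<integral>\<^sup>+x. ennreal \<bar>X x - v\<bar> \<partial>Q)"
    unfolding P Q by (simp add: nn_integral_add nn_integral_density)
  finally show ?thesis .
qed

end

text \<open>Both measures are absolutely continuous with respect to their sum, so the Radon-Nikodym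
  theorem provides densities; finiteness of the measures allows real-valued ones.\<close>

lemma common_real_densities:
  assumes "finite_measure P" "finite_measure Q" and sets: "sets Q = sets P"
  obtains \<nu> and f g :: "'a \<Rightarrow> real"
  where "f \<in> borel_measurable \<nu>" "\<And>x. 0 \<le> f x" "P = density \<nu> (\<lambda>x. ennreal (f x))"
    and "g \<in> borel_measurable \<nu>" "\<And>x. 0 \<le> g x" "Q = density \<nu> (\<lambda>x. ennreal (g x))"
    and "sets \<nu> = sets P"
proof -
  define \<nu> where "\<nu> = sum_measure P Q"
  have sets_\<nu>: "sets \<nu> = sets P" by (simp add: \<nu>_def)
  have emeasure_\<nu>: "emeasure \<nu> A = emeasure P A + emeasure Q A" if "A \<in> sets P" for A
    using that by (simp add: \<nu>_def emeasure_sum_measure sets)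
  have "emeasure \<nu> (space \<nu>) \<noteq> \<infinity>"
    using finite_measure.emeasure_finite[OF assms(1)] finite_measure.emeasure_finite[OF assms(2)]
    by (simp add: emeasure_\<nu> \<nu>_def emeasure_sum_measure sets)
  then interpret \<nu>: finite_measure \<nu> by (rule finite_measureI)
  have density: "\<exists>h :: 'a \<Rightarrow> real. h \<in> borel_measurable \<nu> \<and> (\<forall>x. 0 \<le> h x) \<and> N = density \<nu> (\<lambda>x. ennreal (h x))"
    if fin: "finite_measure N" and N: "sets N = sets \<nu>" and ac: "absolutely_continuous \<nu> N" for N
  proof -
    obtain h where h [measurable]: "h \<in> borel_measurable \<nu>"
      and eq: "AE x in \<nu>. RN_deriv \<nu> N x = ennreal (h x)" and h0: "\<And>x. 0 \<le> h x"
      using \<nu>.real_RN_deriv[OF fin ac N] by metis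
    have "N = density \<nu> (RN_deriv \<nu> N)" using \<nu>.density_RN_deriv[OF ac N] by simp
    also have "\<dots> = density \<nu> (\<lambda>x. ennreal (h x))" using eq by (intro density_cong) auto
    finally show ?thesis using h h0 by blast
  qed
  have "absolutely_continuous \<nu> P" "absolutely_continuous \<nu> Q"
    by (auto simp: absolutely_continuous_def null_sets_def sets_\<nu> emeasure_\<nu> sets)
  with density[OF assms(1)] density[OF assms(2)] sets sets_\<nu> that show thesis by metis
qed

theorem lemma3p1:
  fixes P Q :: "'a measure" and X :: "'a \<Rightarrow> real" and u v :: real
  assumes "prob_space P" and "prob_space Q" and "sets Q = sets P"
    and "X \<in> borel_measurable P"
  shows "ennreal (1 / 5 * (1 - hellinger_sq P Q)\<^sup>2 * \<bar>u - v\<bar>)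
         \<le> max (\<integral>\<^sup>+x. ennreal \<bar>X x - u\<bar> \<partial>P) (\<integral>\<^sup>+x. ennreal \<bar>X x - v\<bar> \<partial>Q)"
    (is "ennreal ?lhs \<le> max ?EP ?EQ")
proof -
  obtain \<nu> and f g :: "'a \<Rightarrow> real" where fg:
    "f \<in> borel_measurable \<nu>" "\<And>x. 0 \<le> f x" "P = density \<nu> (\<lambda>x. ennreal (f x))"
    "g \<in> borel_measurable \<nu>" "\<And>x. 0 \<le> g x" "Q = density \<nu> (\<lambda>x. ennreal (g x))"
    and sets_\<nu>: "sets \<nu> = sets P"
    using common_real_densities assms(1-3) by (metis prob_space.finite_measure)
  note densities = fg(1,2,4,5,3) assms(1) fg(6) assms(2)
  have X: "X \<in> borel_measurable \<nu>"
    using assms(4) measurable_cong_sets[OF sets_\<nu> refl] by blast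
  define m where "m = (\<integral>x. min (f x) (g x) \<partial>\<nu>)"
  have "(1 - hellinger_sq P Q)\<^sup>2 \<le> 2 * m"
    unfolding m_def by (rule affinity_sq_le_overlap[OF densities])
  then have "1 / 5 * (1 - hellinger_sq P Q)\<^sup>2 \<le> m / 2"
    using zero_le_power2[of "1 - hellinger_sq P Q"] by linarith
  then have lhs: "?lhs \<le> m * \<bar>u - v\<bar> / 2"
    using mult_right_mono[of _ _ "\<bar>u - v\<bar>"] by fastforce
  have "2 * ennreal ?lhs = ennreal (2 * ?lhs)"
    by (subst ennreal_mult) auto
  also have "\<dots> \<le> ennreal (m * \<bar>u - v\<bar>)"
    using lhs by (intro ennreal_leI) simp
  also have "\<dots> \<le> ?EP + ?EQ"
    unfolding m_def by (rule overlap_triangle[OF densities X])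
  also have "\<dots> \<le> 2 * max ?EP ?EQ"
    unfolding mult_2 by (intro add_mono) auto
  finally show ?thesis
    by (subst (asm) ennreal_mult_le_mult_iff) auto
qed

end
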